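(* Let $H$ be a non-coassociative bimonoid in $\mathsf{C}$ and let $J:K\to H\otimes H$ be a conormal twist. Define the coproduct $$\delta_{H_J}=\mu_{H\otimes H}\circ(\mu_{H\otimes H}\otimes H\otimes H)\circ(J^{-1}\otimes\delta_H\otimes J):H\to H\otimes H.$$ Then $$H_J=(H,\ \eta_{H_J}=\eta_H,\ \mu_{H_J}=\mu_H,\ \varepsilon_{H_J}=\varepsilon_H,\ \delta_{H_J})$$ is a non-coassociative bimonoid (called the twist deformation of $H$ by $J$).
   Context: $\mathsf{C}$ is a strict symmetric monoidal category with tensor product $\otimes$, unit object $K$ and symmetry $c$. For an object $P$ and a morphism $f$, write $P\otimes f$ for $\mathrm{id}_P\otimes f$ and $f\otimes P$ for $f\otimes \mathrm{id}_P$. For monoids $A,B$, the object $A\otimes B$ is a monoid with unit $\eta_A\otimes\eta_B$ and product $\mu_{A\otimes B}=(\mu_A\otimes\mu_B)\circ(A\otimes c_{B,A}\otimes B)$. A counital comagma is a triple $(D,\varepsilon_D,\delta_D)$ with $\varepsilon_D:D\to K$, $\delta_D:D\to D\otimes D$ such that $(\varepsilon_D\otimes D)\circ\delta_D=\mathrm{id}_D=(D\otimes\varepsilon_D)\circ\delta_D$ (no coassociativity required). A non-coassociative bimonoid is an object $H$ with a monoid structure $(H,\eta_H,\mu_H)$ (unital and associative) and a counital comagma structure $(H,\varepsilon_H,\delta_H)$ such that $\varepsilon_H\circ\eta_H=\mathrm{id}_K$, $\delta_H\circ\eta_H=\eta_H\otimes\eta_H$, $\varepsilon_H\circ\mu_H=\varepsilon_H\otimes\varepsilon_H$,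 and $\delta_H\circ\mu_H=\mu_{H\otimes H}\circ(\delta_H\otimes\delta_H)$. For a monoid $A$ and $f,g:K\to A$, the convolution product is $f\ast g=\mu_A\circ(f\otimes g)$; $f$ is convolution invertible if there is $f^{-1}:K\to A$ with $f\ast f^{-1}=f^{-1}\ast f=\eta_A$. A twist for $H$ is a convolution invertible morphism $J:K\to H\otimes H$ (convolution taken in the monoid $H\otimes H$), with inverse $J^{-1}$, such that, in the monoid $H\otimes H\otimes H$, $$((\delta_H\otimes H)\circ J)\ast(J\otimes\eta_H)=((H\otimes\delta_H)\circ J)\ast(\eta_H\otimes J).$$ $J$ is conormal if $(\varepsilon_H\otimes H)\circ J=\eta_H=(H\otimes\varepsilon_H)\circ J$. *)

theory Defs
  imports Main
begin

section \<open>Strict symmetric monoidal categories\<close>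

record ('o, 'm) monoidal_data =
  Obj :: "'o set"
  Arr :: "'m set"
  Dom :: "'m \<Rightarrow> 'o"
  Cod :: "'m \<Rightarrow> 'o"
  IdA :: "'o \<Rightarrow> 'm"  (\<open>\<i>\<d>\<index>\<close>)
  Comp :: "'m \<Rightarrow> 'm \<Rightarrow> 'm"  (infixr \<open>\<cdot>\<index>\<close> 60)
  TensorO :: "'o \<Rightarrow> 'o \<Rightarrow> 'o"  (infixl \<open>\<odot>\<index>\<close> 70)
  TensorA :: "'m \<Rightarrow> 'm \<Rightarrow> 'm"  (infixl \<open>\<otimes>\<index>\<close> 70)
  UnitO :: "'o"  (\<open>\<K>\<index>\<close>)
  Sym :: "'o \<Rightarrow> 'o \<Rightarrow> 'm"  (\<open>\<c>\<index>\<close>)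

definition hom_set :: "('o, 'm, 'x) monoidal_data_scheme \<Rightarrow> 'o \<Rightarrow> 'o \<Rightarrow> 'm set"  (\<open>Hom\<index>\<close>)
  where "Hom\<^bsub>C\<^esub> X Y = {f \<in> Arr C. Dom C f = X \<and> Cod C f = Y}"

locale category =
  fixes C (structure)
  assumes Dom_in: "f \<in> Arr C \<Longrightarrow> Dom C f \<in> Obj C"
    and Cod_in: "f \<in> Arr C \<Longrightarrow> Cod C f \<in> Obj C"
    and Id_in: "X \<in> Obj C \<Longrightarrow> \<i>\<d> X \<in> Hom X X"
    and Comp_in: "f \<in> Hom X Y \<Longrightarrow> g \<in> Hom Y Z \<Longrightarrow> g \<cdot> f \<in> Hom X Z"
    and Comp_Id_left: "f \<in> Hom X Y \<Longrightarrow> \<i>\<d> Y \<cdot> f = f"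
    and Comp_Id_right: "f \<in> Hom X Y \<Longrightarrow> f \<cdot> \<i>\<d> X = f"
    and Comp_assoc:
      "f \<in> Hom W X \<Longrightarrow> g \<in> Hom X Y \<Longrightarrow> h \<in> Hom Y Z \<Longrightarrow> (h \<cdot> g) \<cdot> f = h \<cdot> (g \<cdot> f)"

locale strict_monoidal_category = category +
  assumes UnitO_in: "\<K> \<in> Obj C"
    and TensorO_in: "X \<in> Obj C \<Longrightarrow> Y \<in> Obj C \<Longrightarrow> X \<odot> Y \<in> Obj C"
    and TensorA_in:
      "f \<in> Hom X Y \<Longrightarrow> g \<in> Hom X' Y' \<Longrightarrow> f \<otimes> g \<in> Hom (X \<odot> X') (Y \<odot> Y')"
    and TensorA_Id: "X \<in> Obj C \<Longrightarrow> Y \<in> Obj C \<Longrightarrow> \<i>\<d> X \<otimes> \<i>\<d> Y = \<i>\<d> (X \<odot> Y)"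
    and interchange:
      "f \<in> Hom X Y \<Longrightarrow> g \<in> Hom Y Z \<Longrightarrow> f' \<in> Hom X' Y' \<Longrightarrow> g' \<in> Hom Y' Z' \<Longrightarrow>
        (g \<cdot> f) \<otimes> (g' \<cdot> f') = (g \<otimes> g') \<cdot> (f \<otimes> f')"
    and TensorO_assoc:
      "X \<in> Obj C \<Longrightarrow> Y \<in> Obj C \<Longrightarrow> Z \<in> Obj C \<Longrightarrow> (X \<odot> Y) \<odot> Z = X \<odot> (Y \<odot> Z)"
    and TensorA_assoc:
      "f \<in> Arr C \<Longrightarrow> g \<in> Arr C \<Longrightarrow> h \<in> Arr C \<Longrightarrow> (f \<otimes> g) \<otimes> h = f \<otimes> (g \<otimes> h)"
    and TensorO_unit_left: "X \<in> Obj C \<Longrightarrow> \<K> \<odot> X = X"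
    and TensorO_unit_right: "X \<in> Obj C \<Longrightarrow> X \<odot> \<K> = X"
    and TensorA_unit_left: "f \<in> Arr C \<Longrightarrow> \<i>\<d> \<K> \<otimes> f = f"
    and TensorA_unit_right: "f \<in> Arr C \<Longrightarrow> f \<otimes> \<i>\<d> \<K> = f"

text \<open>The second hexagon identity and \<open>\<c> X \<K> = \<i>\<d> X = \<c> \<K> X\<close> follow from the axioms below.\<close>

locale strict_symmetric_monoidal_category = strict_monoidal_category +
  assumes Sym_in: "X \<in> Obj C \<Longrightarrow> Y \<in> Obj C \<Longrightarrow> \<c> X Y \<in> Hom (X \<odot> Y) (Y \<odot> X)"
    and Sym_natural:
      "f \<in> Hom X X' \<Longrightarrow> g \<in> Hom Y Y' \<Longrightarrow> \<c> X' Y' \<cdot> (f \<otimes> g) = (g \<otimes> f) \<cdot> \<c> X Y"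
    and Sym_Sym: "X \<in> Obj C \<Longrightarrow> Y \<in> Obj C \<Longrightarrow> \<c> Y X \<cdot> \<c> X Y = \<i>\<d> (X \<odot> Y)"
    and hexagon:
      "X \<in> Obj C \<Longrightarrow> Y \<in> Obj C \<Longrightarrow> Z \<in> Obj C \<Longrightarrow>
        \<c> (X \<odot> Y) Z = (\<c> X Z \<otimes> \<i>\<d> Y) \<cdot> (\<i>\<d> X \<otimes> \<c> Y Z)"


section \<open>Monoids, comagmas and non-coassociative bimonoids\<close>

record ('o, 'm) monoid_data =
  obj :: "'o"
  unit :: "'m"  (\<open>\<eta>\<index>\<close>)
  mult :: "'m"  (\<open>\<mu>\<index>\<close>)

record ('o, 'm) bimonoid_data = "('o, 'm) monoid_data" +
  counit :: "'m"  (\<open>\<epsilon>\<index>\<close>)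
  comult :: "'m"  (\<open>\<delta>\<index>\<close>)

locale monoid_object = strict_symmetric_monoidal_category C for C (structure) +
  fixes A :: "('o, 'm, 'y) monoid_data_scheme"
  assumes obj_in: "obj A \<in> Obj C"
    and unit_in: "\<eta>\<^bsub>A\<^esub> \<in> Hom \<K> (obj A)"
    and mult_in: "\<mu>\<^bsub>A\<^esub> \<in> Hom (obj A \<odot> obj A) (obj A)"
    and unit_left: "\<mu>\<^bsub>A\<^esub> \<cdot> (\<eta>\<^bsub>A\<^esub> \<otimes> \<i>\<d> (obj A)) = \<i>\<d> (obj A)"
    and unit_right: "\<mu>\<^bsub>A\<^esub> \<cdot> (\<i>\<d> (obj A) \<otimes> \<eta>\<^bsub>A\<^esub>) = \<i>\<d> (obj A)"
    and mult_assoc: "\<mu>\<^bsub>A\<^esub> \<cdot> (\<mu>\<^bsub>A\<^esub> \<otimes> \<i>\<d> (obj A)) = \<mu>\<^bsub>A\<^esub> \<cdot> (\<i>\<d> (obj A) \<otimes> \<mu>\<^bsub>A\<^esub>)"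

locale counital_comagma = strict_symmetric_monoidal_category C for C (structure) +
  fixes D :: 'o and e d :: 'm
  assumes comagma_obj_in: "D \<in> Obj C"
    and counit_in: "e \<in> Hom D \<K>"
    and comult_in: "d \<in> Hom D (D \<odot> D)"
    and counit_left: "(e \<otimes> \<i>\<d> D) \<cdot> d = \<i>\<d> D"
    and counit_right: "(\<i>\<d> D \<otimes> e) \<cdot> d = \<i>\<d> D"

definition tensor_monoid ::
    "('o, 'm, 'x) monoidal_data_scheme \<Rightarrow> ('o, 'm, 'y) monoid_data_scheme \<Rightarrow>
      ('o, 'm, 'z) monoid_data_scheme \<Rightarrow> ('o, 'm) monoid_data"  (infixl \<open>\<otimes>\<^sub>M\<index>\<close> 70)
  where "tensor_monoid C A B =
    \<lparr> obj = obj A \<odot>\<^bsub>C\<^esub> obj B,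
      unit = \<eta>\<^bsub>A\<^esub> \<otimes>\<^bsub>C\<^esub> \<eta>\<^bsub>B\<^esub>,
      mult = (\<mu>\<^bsub>A\<^esub> \<otimes>\<^bsub>C\<^esub> \<mu>\<^bsub>B\<^esub>) \<cdot>\<^bsub>C\<^esub>
        (\<i>\<d>\<^bsub>C\<^esub> (obj A) \<otimes>\<^bsub>C\<^esub> \<c>\<^bsub>C\<^esub> (obj B) (obj A) \<otimes>\<^bsub>C\<^esub> \<i>\<d>\<^bsub>C\<^esub> (obj B)) \<rparr>"

locale noncoassociative_bimonoid =
  monoid_object C H + counital_comagma C "obj H" "\<epsilon>\<^bsub>H\<^esub>" "\<delta>\<^bsub>H\<^esub>"
  for C (structure) and H :: "('o, 'm, 'z) bimonoid_data_scheme" +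
  assumes counit_unit: "\<epsilon>\<^bsub>H\<^esub> \<cdot> \<eta>\<^bsub>H\<^esub> = \<i>\<d> \<K>"
    and comult_unit: "\<delta>\<^bsub>H\<^esub> \<cdot> \<eta>\<^bsub>H\<^esub> = \<eta>\<^bsub>H\<^esub> \<otimes> \<eta>\<^bsub>H\<^esub>"
    and counit_mult: "\<epsilon>\<^bsub>H\<^esub> \<cdot> \<mu>\<^bsub>H\<^esub> = \<epsilon>\<^bsub>H\<^esub> \<otimes> \<epsilon>\<^bsub>H\<^esub>"
    and comult_mult: "\<delta>\<^bsub>H\<^esub> \<cdot> \<mu>\<^bsub>H\<^esub> = mult (H \<otimes>\<^sub>M H) \<cdot> (\<delta>\<^bsub>H\<^esub> \<otimes> \<delta>\<^bsub>H\<^esub>)"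


section \<open>Convolution, twists and twist deformations\<close>

definition convolution ::
    "('o, 'm, 'x) monoidal_data_scheme \<Rightarrow> ('o, 'm, 'y) monoid_data_scheme \<Rightarrow> 'm \<Rightarrow> 'm \<Rightarrow> 'm"
  where "convolution C A f g = \<mu>\<^bsub>A\<^esub> \<cdot>\<^bsub>C\<^esub> (f \<otimes>\<^bsub>C\<^esub> g)"

definition is_convolution_inverse ::
    "('o, 'm, 'x) monoidal_data_scheme \<Rightarrow> ('o, 'm, 'y) monoid_data_scheme \<Rightarrow> 'm \<Rightarrow> 'm \<Rightarrow> bool"
  where "is_convolution_inverse C A f g \<longleftrightarrow>
    g \<in> Hom\<^bsub>C\<^esub> \<K>\<^bsub>C\<^esub> (obj A) \<and> convolution C A f g = \<eta>\<^bsub>A\<^esub> \<and> convolution C A g f = \<eta>\<^bsub>A\<^esub>"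

definition convolution_invertible ::
    "('o, 'm, 'x) monoidal_data_scheme \<Rightarrow> ('o, 'm, 'y) monoid_data_scheme \<Rightarrow> 'm \<Rightarrow> bool"
  where "convolution_invertible C A f \<longleftrightarrow> (\<exists>g. is_convolution_inverse C A f g)"

text \<open>Meaningful only for convolution invertible \<open>f : \<K> \<rightarrow> A\<close> into a monoid \<open>A\<close>; associativity of
  the convolution product then makes the inverse unique.\<close>

definition convolution_inverse ::
    "('o, 'm, 'x) monoidal_data_scheme \<Rightarrow> ('o, 'm, 'y) monoid_data_scheme \<Rightarrow> 'm \<Rightarrow> 'm"
  where "convolution_inverse C A f = (THE g. is_convolution_inverse C A f g)"

text \<open>The triple tensor monoid is bracketed to the left; by strictness and the hexagon identities
  the other bracketing gives the same monoid.\<close>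

definition twist ::
    "('o, 'm, 'x) monoidal_data_scheme \<Rightarrow> ('o, 'm, 'z) bimonoid_data_scheme \<Rightarrow> 'm \<Rightarrow> bool"
  where "twist C H J \<longleftrightarrow>
    J \<in> Hom\<^bsub>C\<^esub> \<K>\<^bsub>C\<^esub> (obj H \<odot>\<^bsub>C\<^esub> obj H) \<and>
    convolution_invertible C (H \<otimes>\<^sub>M\<^bsub>C\<^esub> H) J \<and>
    convolution C (H \<otimes>\<^sub>M\<^bsub>C\<^esub> H \<otimes>\<^sub>M\<^bsub>C\<^esub> H)
        ((\<delta>\<^bsub>H\<^esub> \<otimes>\<^bsub>C\<^esub> \<i>\<d>\<^bsub>C\<^esub> (obj H)) \<cdot>\<^bsub>C\<^esub> J) (J \<otimes>\<^bsub>C\<^esub> \<eta>\<^bsub>H\<^esub>) =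
      convolution C (H \<otimes>\<^sub>M\<^bsub>C\<^esub> H \<otimes>\<^sub>M\<^bsub>C\<^esub> H)
        ((\<i>\<d>\<^bsub>C\<^esub> (obj H) \<otimes>\<^bsub>C\<^esub> \<delta>\<^bsub>H\<^esub>) \<cdot>\<^bsub>C\<^esub> J) (\<eta>\<^bsub>H\<^esub> \<otimes>\<^bsub>C\<^esub> J)"

definition conormal ::
    "('o, 'm, 'x) monoidal_data_scheme \<Rightarrow> ('o, 'm, 'z) bimonoid_data_scheme \<Rightarrow> 'm \<Rightarrow> bool"
  where "conormal C H J \<longleftrightarrow>
    (\<epsilon>\<^bsub>H\<^esub> \<otimes>\<^bsub>C\<^esub> \<i>\<d>\<^bsub>C\<^esub> (obj H)) \<cdot>\<^bsub>C\<^esub> J = \<eta>\<^bsub>H\<^esub> \<and>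
    (\<i>\<d>\<^bsub>C\<^esub> (obj H) \<otimes>\<^bsub>C\<^esub> \<epsilon>\<^bsub>H\<^esub>) \<cdot>\<^bsub>C\<^esub> J = \<eta>\<^bsub>H\<^esub>"

definition twisted_comult ::
    "('o, 'm, 'x) monoidal_data_scheme \<Rightarrow> ('o, 'm, 'z) bimonoid_data_scheme \<Rightarrow> 'm \<Rightarrow> 'm"
  where "twisted_comult C H J =
    mult (H \<otimes>\<^sub>M\<^bsub>C\<^esub> H) \<cdot>\<^bsub>C\<^esub>
    (mult (H \<otimes>\<^sub>M\<^bsub>C\<^esub> H) \<otimes>\<^bsub>C\<^esub> \<i>\<d>\<^bsub>C\<^esub> (obj H) \<otimes>\<^bsub>C\<^esub> \<i>\<d>\<^bsub>C\<^esub> (obj H)) \<cdot>\<^bsub>C\<^esub>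
    (convolution_inverse C (H \<otimes>\<^sub>M\<^bsub>C\<^esub> H) J \<otimes>\<^bsub>C\<^esub> \<delta>\<^bsub>H\<^esub> \<otimes>\<^bsub>C\<^esub> J)"

definition twist_deformation ::
    "('o, 'm, 'x) monoidal_data_scheme \<Rightarrow> ('o, 'm, 'z) bimonoid_data_scheme \<Rightarrow> 'm \<Rightarrow>
      ('o, 'm) bimonoid_data"
  where "twist_deformation C H J =
    \<lparr> obj = obj H, unit = \<eta>\<^bsub>H\<^esub>, mult = \<mu>\<^bsub>H\<^esub>, counit = \<epsilon>\<^bsub>H\<^esub>, comult = twisted_comult C H J \<rparr>"

end

theory Submission
  imports Defs
begin

text \<open>For a monoid \<open>A\<close>, the convolution \<open>f * g = \<mu> \<cdot> (f \<otimes> g)\<close> makes sense for all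
  \<open>f : X \<rightarrow> A\<close> and \<open>g : Y \<rightarrow> A\<close>, with result \<open>X \<odot> Y \<rightarrow> A\<close>. It is associative, has \<open>\<eta>\<close> as unit,
  satisfies \<open>(f * g) \<cdot> (h \<otimes> k) = (f \<cdot> h) * (g \<cdot> k)\<close>, and every monoid morphism out of \<open>A\<close>
  distributes over it. So morphisms into \<open>A\<close> multiply like elements of an ordinary monoid.

  Write \<open>i\<close> for the inverse of \<open>J\<close>. In the monoid \<open>H \<otimes>\<^sub>M H\<close> the twisted coproduct is
  \<open>i * \<delta> * J\<close>, that is, \<open>\<delta>\<close> conjugated by \<open>J\<close>. Conjugation respects unit and convolution, hence
  \<open>(i * \<delta> * J) \<cdot> \<eta> = i * \<eta> * J = \<eta>\<close> and, since \<open>\<delta> \<cdot> \<mu> = \<delta> * \<delta>\<close>,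
  \<open>(i * \<delta> * J) \<cdot> \<mu> = i * \<delta> * \<delta> * J = (i * \<delta> * J) * (i * \<delta> * J)\<close>; the last step inserts
  \<open>J * i = \<eta>\<close> (lemmas \<open>conjugate_comp\<close> and \<open>conjugate_convolution\<close>).
  For the counit laws, \<open>\<epsilon> \<otimes> \<i>\<d>\<close> and \<open>\<i>\<d> \<otimes> \<epsilon>\<close> are monoid morphisms from \<open>H \<otimes>\<^sub>M H\<close> to \<open>H\<close>
  that send \<open>J\<close> to \<open>\<eta>\<close>, because \<open>J\<close> is conormal. They then send \<open>i\<close> to \<open>\<eta>\<close> too, so that they
  do not distinguish \<open>i * \<delta> * J\<close> from \<open>\<delta>\<close> (lemma \<open>morphism_conjugate\<close>).

  What remains is that \<open>H \<otimes>\<^sub>M H\<close> is a monoid at all (lemma \<open>tensor_monoid_object\<close>), and that the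
  tensor product of monoid morphisms is one. Both follow from naturality of the symmetry and
  the two hexagon identities.\<close>

section \<open>Composition and tensor of arrows\<close>

context category
begin

text \<open>Domain and codomain equations as conditional rewrite rules let the simplifier check that
  composites are well typed, including the identifications of objects by strictness.\<close>

lemma hom_iff: "f \<in> Hom X Y \<longleftrightarrow> f \<in> Arr C \<and> Dom C f = X \<and> Cod C f = Y"
  by (simp add: hom_set_def)

lemma Dom_Cod_Obj [simp]:
  assumes "f \<in> Arr C"
  shows "Dom C f \<in> Obj C" "Cod C f \<in> Obj C"
  using assms Dom_in Cod_in by auto

lemma Id_typing [simp]:
  assumes "X \<in> Obj C"
  shows "\<i>\<d> X \<in> Arr C" "Dom C (\<i>\<d> X) = X" "Cod C (\<i>\<d> X) = X"
  using Id_in[OF assms] by (auto simp: hom_iff)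

lemma Comp_typing [simp]:
  assumes "f \<in> Arr C" "g \<in> Arr C" "Dom C g = Cod C f"
  shows "g \<cdot> f \<in> Arr C" "Dom C (g \<cdot> f) = Dom C f" "Cod C (g \<cdot> f) = Cod C g"
  using Comp_in[of f "Dom C f" "Cod C f" g "Cod C g"] assms by (auto simp: hom_iff)

lemma Comp_Id [simp]:
  assumes "f \<in> Arr C"
  shows "Cod C f = X \<Longrightarrow> \<i>\<d> X \<cdot> f = f" "Dom C f = X \<Longrightarrow> f \<cdot> \<i>\<d> X = f"
  using assms Comp_Id_left[of f "Dom C f" "Cod C f"] Comp_Id_right[of f "Dom C f" "Cod C f"]
  by (auto simp: hom_iff)

lemma Comp_assoc_arr:
  assumes "f \<in> Arr C" "g \<in> Arr C" "h \<in> Arr C" "Dom C g = Cod C f" "Dom C h = Cod C g"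
  shows "(h \<cdot> g) \<cdot> f = h \<cdot> (g \<cdot> f)"
  using Comp_assoc[of f _ _ g _ h] assms by (auto simp: hom_iff)

end

context strict_monoidal_category
begin

declare UnitO_in [simp] TensorO_in [simp] TensorA_Id [simp]
  TensorO_assoc [simp] TensorA_assoc [simp] TensorO_unit_left [simp] TensorO_unit_right [simp]
  TensorA_unit_left [simp] TensorA_unit_right [simp]

lemma TensorA_typing [simp]:
  assumes "f \<in> Arr C" "g \<in> Arr C"
  shows "f \<otimes> g \<in> Arr C" "Dom C (f \<otimes> g) = Dom C f \<odot> Dom C g"
    "Cod C (f \<otimes> g) = Cod C f \<odot> Cod C g"
  using TensorA_in[of f "Dom C f" "Cod C f" g "Dom C g" "Cod C g"] assms by (auto simp: hom_iff)

lemma interchange_arr: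
  assumes "f \<in> Arr C" "g \<in> Arr C" "f' \<in> Arr C" "g' \<in> Arr C"
    "Dom C g = Cod C f" "Dom C g' = Cod C f'"
  shows "(g \<otimes> g') \<cdot> (f \<otimes> f') = (g \<cdot> f) \<otimes> (g' \<cdot> f')"
  using interchange[of f _ _ g _ f' _ _ g'] assms by (auto simp: hom_iff)

lemma interchange3:
  assumes "f \<in> Arr C" "g \<in> Arr C" "f' \<in> Arr C" "g' \<in> Arr C" "f'' \<in> Arr C" "g'' \<in> Arr C"
    "Dom C g = Cod C f" "Dom C g' = Cod C f'" "Dom C g'' = Cod C f''"
  shows "(g \<otimes> (g' \<otimes> g'')) \<cdot> (f \<otimes> (f' \<otimes> f'')) = (g \<cdot> f) \<otimes> ((g' \<cdot> f') \<otimes> (g'' \<cdot> f''))"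
  using assms by (simp add: interchange_arr)

end

section \<open>The symmetry\<close>

context strict_symmetric_monoidal_category
begin

lemma Sym_typing [simp]:
  assumes "X \<in> Obj C" "Y \<in> Obj C"
  shows "\<c> X Y \<in> Arr C" "Dom C (\<c> X Y) = X \<odot> Y" "Cod C (\<c> X Y) = Y \<odot> X"
  using Sym_in[OF assms] by (auto simp: hom_iff)

lemma Sym_natural_arr:
  assumes "f \<in> Arr C" "g \<in> Arr C" "Cod C f = X" "Cod C g = Y"
  shows "\<c> X Y \<cdot> (f \<otimes> g) = (g \<otimes> f) \<cdot> \<c> (Dom C f) (Dom C g)"
  using Sym_natural[of f _ X g _ Y] assms by (auto simp: hom_iff)

text \<open>The hexagon identity makes \<open>\<c> \<K> X\<close> idempotent, and an idempotent isomorphism is an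
  identity.\<close>

lemma Sym_unit [simp]:
  assumes "X \<in> Obj C"
  shows "\<c> \<K> X = \<i>\<d> X" "\<c> X \<K> = \<i>\<d> X"
proof -
  have idem: "\<c> \<K> X \<cdot> \<c> \<K> X = \<c> \<K> X"
    using hexagon[of \<K> \<K> X] assms by simp
  have inv: "\<c> X \<K> \<cdot> \<c> \<K> X = \<i>\<d> X"
    using Sym_Sym[of \<K> X] assms by simp
  have "\<c> \<K> X = (\<c> X \<K> \<cdot> \<c> \<K> X) \<cdot> \<c> \<K> X"
    using assms by (simp add: inv)
  also have "\<dots> = \<i>\<d> X"
    using assms by (subst Comp_assoc_arr) (simp_all add: idem inv)
  finally show K: "\<c> \<K> X = \<i>\<d> X" .
  show "\<c> X \<K> = \<i>\<d> X"
    using inv assms by (simp add: K)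
qed

text \<open>Both sides are inverse to \<open>\<c> (Y \<odot> Z) X\<close>, the right one by the first hexagon identity.\<close>

lemma hexagon2:
  assumes [simp]: "X \<in> Obj C" "Y \<in> Obj C" "Z \<in> Obj C"
  shows "\<c> X (Y \<odot> Z) = (\<i>\<d> Y \<otimes> \<c> X Z) \<cdot> (\<c> X Y \<otimes> \<i>\<d> Z)"
proof -
  let ?r = "(\<i>\<d> Y \<otimes> \<c> X Z) \<cdot> (\<c> X Y \<otimes> \<i>\<d> Z)"
  have inner: "(\<i>\<d> Y \<otimes> \<c> Z X) \<cdot> (\<i>\<d> Y \<otimes> \<c> X Z) = \<i>\<d> Y \<otimes> (\<i>\<d> X \<otimes> \<i>\<d> Z)"
    by (simp add: interchange_arr Sym_Sym)
  have "\<c> (Y \<odot> Z) X \<cdot> ?r =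
      (\<c> Y X \<otimes> \<i>\<d> Z) \<cdot> (((\<i>\<d> Y \<otimes> \<c> Z X) \<cdot> (\<i>\<d> Y \<otimes> \<c> X Z)) \<cdot> (\<c> X Y \<otimes> \<i>\<d> Z))"
    by (simp add: hexagon Comp_assoc_arr)
  also have "\<dots> = (\<c> Y X \<otimes> \<i>\<d> Z) \<cdot> (\<c> X Y \<otimes> \<i>\<d> Z)"
    by (simp add: inner)
  also have "\<dots> = \<i>\<d> (X \<odot> (Y \<odot> Z))"
    by (simp add: interchange_arr Sym_Sym)
  finally have right_inv: "\<c> (Y \<odot> Z) X \<cdot> ?r = \<i>\<d> (X \<odot> (Y \<odot> Z))" .
  have "\<c> X (Y \<odot> Z) = \<c> X (Y \<odot> Z) \<cdot> (\<c> (Y \<odot> Z) X \<cdot> ?r)"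
    by (simp add: right_inv)
  also have "\<dots> = (\<c> X (Y \<odot> Z) \<cdot> \<c> (Y \<odot> Z) X) \<cdot> ?r"
    by (simp add: Comp_assoc_arr)
  also have "\<dots> = ?r"
    using Sym_Sym[of "Y \<odot> Z" X] by simp
  finally show ?thesis .
qed

end

section \<open>Convolution of generalized elements\<close>

context monoid_object
begin

lemma monoid_typing [simp]:
  "obj A \<in> Obj C"
  "\<eta>\<^bsub>A\<^esub> \<in> Arr C" "Dom C \<eta>\<^bsub>A\<^esub> = \<K>" "Cod C \<eta>\<^bsub>A\<^esub> = obj A"
  "\<mu>\<^bsub>A\<^esub> \<in> Arr C" "Dom C \<mu>\<^bsub>A\<^esub> = obj A \<odot> obj A" "Cod C \<mu>\<^bsub>A\<^esub> = obj A"
  using obj_in unit_in mult_in by (auto simp: hom_iff)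

lemma convolution_typing [simp]:
  assumes "f \<in> Arr C" "g \<in> Arr C" "Cod C f = obj A" "Cod C g = obj A"
  shows "convolution C A f g \<in> Arr C"
    "Dom C (convolution C A f g) = Dom C f \<odot> Dom C g"
    "Cod C (convolution C A f g) = obj A"
  using assms by (simp_all add: convolution_def)

lemma convolution_comp:
  assumes "f \<in> Arr C" "g \<in> Arr C" "Cod C f = obj A" "Cod C g = obj A"
    and "h \<in> Arr C" "k \<in> Arr C" "Cod C h = Dom C f" "Cod C k = Dom C g"
  shows "convolution C A f g \<cdot> (h \<otimes> k) = convolution C A (f \<cdot> h) (g \<cdot> k)"
  using assms by (simp add: convolution_def Comp_assoc_arr interchange_arr)

lemma convolution_assoc:
  assumes "f \<in> Arr C" "g \<in> Arr C" "h \<in> Arr C"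
    and "Cod C f = obj A" "Cod C g = obj A" "Cod C h = obj A"
  shows "convolution C A (convolution C A f g) h = convolution C A f (convolution C A g h)"
proof -
  have "convolution C A (convolution C A f g) h =
      (\<mu>\<^bsub>A\<^esub> \<cdot> (\<mu>\<^bsub>A\<^esub> \<otimes> \<i>\<d> (obj A))) \<cdot> ((f \<otimes> g) \<otimes> h)"
    using assms by (simp add: convolution_def Comp_assoc_arr interchange_arr del: TensorA_assoc)
  also have "\<dots> = \<mu>\<^bsub>A\<^esub> \<cdot> ((\<i>\<d> (obj A) \<otimes> \<mu>\<^bsub>A\<^esub>) \<cdot> (f \<otimes> (g \<otimes> h)))"
    using assms by (simp add: mult_assoc Comp_assoc_arr)
  also have "\<dots> = convolution C A f (convolution C A g h)"
    using assms by (simp add: convolution_def interchange_arr)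
  finally show ?thesis .
qed

lemma convolution_unit [simp]:
  assumes "f \<in> Arr C" "Cod C f = obj A"
  shows "convolution C A \<eta>\<^bsub>A\<^esub> f = f" "convolution C A f \<eta>\<^bsub>A\<^esub> = f"
proof -
  have "convolution C A \<eta>\<^bsub>A\<^esub> f = convolution C A \<eta>\<^bsub>A\<^esub> (\<i>\<d> (obj A)) \<cdot> (\<i>\<d> \<K> \<otimes> f)"
    using assms convolution_comp[of "\<eta>\<^bsub>A\<^esub>" "\<i>\<d> (obj A)" "\<i>\<d> \<K>" f] by simp
  then show "convolution C A \<eta>\<^bsub>A\<^esub> f = f"
    using assms by (simp add: convolution_def unit_left)
  have "convolution C A f \<eta>\<^bsub>A\<^esub> = convolution C A (\<i>\<d> (obj A)) \<eta>\<^bsub>A\<^esub> \<cdot> (f \<otimes> \<i>\<d> \<K>)"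
    using assms convolution_comp[of "\<i>\<d> (obj A)" "\<eta>\<^bsub>A\<^esub>" f "\<i>\<d> \<K>"] by simp
  then show "convolution C A f \<eta>\<^bsub>A\<^esub> = f"
    using assms by (simp add: convolution_def unit_right)
qed

text \<open>Precomposition reaches only the middle factor: the outer ones have domain \<open>\<K>\<close>, and
  \<open>h = \<i>\<d> \<K> \<otimes> h \<otimes> \<i>\<d> \<K>\<close>.\<close>

lemma conjugate_comp:
  assumes "i \<in> Hom \<K> (obj A)" "j \<in> Hom \<K> (obj A)"
    and "f \<in> Arr C" "Cod C f = obj A" "h \<in> Arr C" "Cod C h = Dom C f"
  shows "convolution C A (convolution C A i f) j \<cdot> h =
    convolution C A (convolution C A i (f \<cdot> h)) j"
proof -
  have [simp]: "i \<in> Arr C" "Dom C i = \<K>" "Cod C i = obj A"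
    "j \<in> Arr C" "Dom C j = \<K>" "Cod C j = obj A"
    using assms by (auto simp: hom_iff)
  have "convolution C A i f \<cdot> h = convolution C A i (f \<cdot> h)"
    using convolution_comp[of i f "\<i>\<d> \<K>" h] assms by simp
  then show ?thesis
    using convolution_comp[of "convolution C A i f" j h "\<i>\<d> \<K>"] assms by simp
qed

text \<open>The usual computation \<open>i f g j = (i f j) (i g j)\<close>, with \<open>j i\<close> cancelling in the middle.\<close>

lemma conjugate_convolution:
  assumes i: "i \<in> Hom \<K> (obj A)" and j: "j \<in> Hom \<K> (obj A)"
    and ji: "convolution C A j i = \<eta>\<^bsub>A\<^esub>"
    and [simp]: "f \<in> Arr C" "Cod C f = obj A" "g \<in> Arr C" "Cod C g = obj A"
  shows "convolution C A (convolution C A i (convolution C A f g)) j =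
    convolution C A (convolution C A (convolution C A i f) j)
      (convolution C A (convolution C A i g) j)"
proof -
  have [simp]: "i \<in> Arr C" "Cod C i = obj A" "j \<in> Arr C" "Cod C j = obj A"
    using i j by (auto simp: hom_iff)
  have cancel: "convolution C A j (convolution C A i h) = h" if "h \<in> Arr C" "Cod C h = obj A" for h
    using that by (simp add: ji flip: convolution_assoc)
  show ?thesis
    by (simp add: convolution_assoc cancel)
qed

lemma convolution_inverse_unique:
  assumes f: "f \<in> Hom \<K> (obj A)"
    and g: "is_convolution_inverse C A f g" and h: "is_convolution_inverse C A f h"
  shows "g = h"
proof -
  have "g = convolution C A (convolution C A h f) g"
    using g h by (simp add: is_convolution_inverse_def hom_iff)
  also have "\<dots> = convolution C A h (convolution C A f g)"
    using f g h by (intro convolution_assoc) (auto simp: is_convolution_inverse_def hom_iff)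
  also have "\<dots> = h"
    using g h by (simp add: is_convolution_inverse_def hom_iff)
  finally show ?thesis .
qed

lemma convolution_inverse:
  assumes "f \<in> Hom \<K> (obj A)" "convolution_invertible C A f"
  shows "is_convolution_inverse C A f (convolution_inverse C A f)"
proof -
  have "\<exists>!g. is_convolution_inverse C A f g"
    using assms convolution_inverse_unique by (auto simp: convolution_invertible_def)
  then show ?thesis
    unfolding convolution_inverse_def by (rule theI')
qed

end

section \<open>Monoid morphisms and tensor products of monoids\<close>

definition monoid_morphism ::
    "('o, 'm, 'x) monoidal_data_scheme \<Rightarrow> ('o, 'm, 'y) monoid_data_scheme \<Rightarrow>
      ('o, 'm, 'z) monoid_data_scheme \<Rightarrow> 'm \<Rightarrow> bool"
  where "monoid_morphism C A B f \<longleftrightarrow>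
    f \<in> Hom\<^bsub>C\<^esub> (obj A) (obj B) \<and> f \<cdot>\<^bsub>C\<^esub> \<eta>\<^bsub>A\<^esub> = \<eta>\<^bsub>B\<^esub> \<and>
    f \<cdot>\<^bsub>C\<^esub> \<mu>\<^bsub>A\<^esub> = \<mu>\<^bsub>B\<^esub> \<cdot>\<^bsub>C\<^esub> (f \<otimes>\<^bsub>C\<^esub> f)"

definition unit_monoid :: "('o, 'm, 'x) monoidal_data_scheme \<Rightarrow> ('o, 'm) monoid_data"
  where "unit_monoid C = \<lparr> obj = \<K>\<^bsub>C\<^esub>, unit = \<i>\<d>\<^bsub>C\<^esub> \<K>\<^bsub>C\<^esub>, mult = \<i>\<d>\<^bsub>C\<^esub> \<K>\<^bsub>C\<^esub> \<rparr>"

lemma tensor_monoid_sel [simp]: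
  "obj (A \<otimes>\<^sub>M\<^bsub>C\<^esub> B) = obj A \<odot>\<^bsub>C\<^esub> obj B"
  "\<eta>\<^bsub>A \<otimes>\<^sub>M\<^bsub>C\<^esub> B\<^esub> = \<eta>\<^bsub>A\<^esub> \<otimes>\<^bsub>C\<^esub> \<eta>\<^bsub>B\<^esub>"
  "\<mu>\<^bsub>A \<otimes>\<^sub>M\<^bsub>C\<^esub> B\<^esub> = (\<mu>\<^bsub>A\<^esub> \<otimes>\<^bsub>C\<^esub> \<mu>\<^bsub>B\<^esub>) \<cdot>\<^bsub>C\<^esub>
    (\<i>\<d>\<^bsub>C\<^esub> (obj A) \<otimes>\<^bsub>C\<^esub> \<c>\<^bsub>C\<^esub> (obj B) (obj A) \<otimes>\<^bsub>C\<^esub> \<i>\<d>\<^bsub>C\<^esub> (obj B))"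
  by (simp_all add: tensor_monoid_def)

lemma (in monoid_object) monoid_morphism_id: "monoid_morphism C A A (\<i>\<d> (obj A))"
  by (simp add: monoid_morphism_def hom_iff)

lemma (in monoid_object) monoid_morphism_convolution:
  assumes "monoid_morphism C A B \<phi>"
    and "monoid_object C B"
    and "f \<in> Arr C" "g \<in> Arr C" "Cod C f = obj A" "Cod C g = obj A"
  shows "\<phi> \<cdot> convolution C A f g = convolution C B (\<phi> \<cdot> f) (\<phi> \<cdot> g)"
proof -
  interpret B: monoid_object C B by fact
  have \<phi>: "\<phi> \<in> Arr C" "Dom C \<phi> = obj A" "Cod C \<phi> = obj B" "\<phi> \<cdot> \<mu>\<^bsub>A\<^esub> = \<mu>\<^bsub>B\<^esub> \<cdot> (\<phi> \<otimes> \<phi>)"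
    using assms(1) by (auto simp: monoid_morphism_def hom_iff)
  have "\<phi> \<cdot> convolution C A f g = (\<phi> \<cdot> \<mu>\<^bsub>A\<^esub>) \<cdot> (f \<otimes> g)"
    using assms \<phi>(1-3) by (simp add: convolution_def Comp_assoc_arr)
  also have "\<dots> = convolution C B (\<phi> \<cdot> f) (\<phi> \<cdot> g)"
    using assms \<phi> by (simp add: convolution_def Comp_assoc_arr interchange_arr)
  finally show ?thesis .
qed

context strict_symmetric_monoidal_category
begin

text \<open>The middle swap is the permutation in the multiplication of a tensor product of monoids.
  Its naturality moves morphisms past it, after which the two factors can be treated
  separately.\<close>

lemma middle_swap_natural:
  assumes "f \<in> Arr C" "g \<in> Arr C" "h \<in> Arr C" "k \<in> Arr C"
    and "Cod C f = W" "Cod C g = X" "Cod C h = Y" "Cod C k = Z"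
  shows "(\<i>\<d> W \<otimes> (\<c> X Y \<otimes> \<i>\<d> Z)) \<cdot> ((f \<otimes> g) \<otimes> (h \<otimes> k)) =
    ((f \<otimes> h) \<otimes> (g \<otimes> k)) \<cdot> (\<i>\<d> (Dom C f) \<otimes> (\<c> (Dom C g) (Dom C h) \<otimes> \<i>\<d> (Dom C k)))"
proof -
  note [simp] = assms(1-4) assms(5-8)[symmetric]
  have "(\<i>\<d> W \<otimes> (\<c> X Y \<otimes> \<i>\<d> Z)) \<cdot> ((f \<otimes> g) \<otimes> (h \<otimes> k)) =
      (\<i>\<d> W \<otimes> (\<c> X Y \<otimes> \<i>\<d> Z)) \<cdot> (f \<otimes> ((g \<otimes> h) \<otimes> k))"
    by simp
  also have "\<dots> = f \<otimes> ((\<c> X Y \<cdot> (g \<otimes> h)) \<otimes> k)"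
    by (subst interchange3) simp_all
  also have "\<dots> = f \<otimes> (((h \<otimes> g) \<cdot> \<c> (Dom C g) (Dom C h)) \<otimes> k)"
    by (simp add: Sym_natural_arr)
  also have "\<dots> = (f \<otimes> ((h \<otimes> g) \<otimes> k)) \<cdot>
      (\<i>\<d> (Dom C f) \<otimes> (\<c> (Dom C g) (Dom C h) \<otimes> \<i>\<d> (Dom C k)))"
    by (subst interchange3) simp_all
  finally show ?thesis by simp
qed

text \<open>The two ways to sort \<open>X Y X Y X Y\<close> into \<open>X X X Y Y Y\<close> by merging adjacent pairs agree:
  each hexagon identity splits off one last swap of the middle factors, and the
  swaps that come before it act on disjoint factors.\<close>

lemma middle_swap_assoc:
  assumes [simp]: "X \<in> Obj C" "Y \<in> Obj C"
  defines "s \<equiv> \<i>\<d> X \<otimes> (\<c> Y X \<otimes> \<i>\<d> Y)"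
  shows "(\<i>\<d> (X \<odot> X) \<otimes> (\<c> (Y \<odot> Y) X \<otimes> \<i>\<d> Y)) \<cdot> (s \<otimes> \<i>\<d> (X \<odot> Y)) =
    (\<i>\<d> X \<otimes> (\<c> Y (X \<odot> X) \<otimes> \<i>\<d> (Y \<odot> Y))) \<cdot> (\<i>\<d> (X \<odot> Y) \<otimes> s)"
proof -
  let ?c = "\<c> Y X"
  let ?last = "\<i>\<d> X \<otimes> (?c \<otimes> \<i>\<d> Y)"
  have left: "(\<i>\<d> X \<otimes> \<c> (Y \<odot> Y) X) \<cdot> (?c \<otimes> \<i>\<d> (Y \<odot> X)) = ?last \<cdot> (?c \<otimes> ?c)"
  proof -
    have "\<i>\<d> X \<otimes> \<c> (Y \<odot> Y) X = ?last \<cdot> (\<i>\<d> X \<otimes> (\<i>\<d> Y \<otimes> ?c))"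
      by (subst interchange_arr) (simp_all add: hexagon)
    also have "\<i>\<d> X \<otimes> (\<i>\<d> Y \<otimes> ?c) = \<i>\<d> (X \<odot> Y) \<otimes> ?c"
      by (simp flip: TensorA_Id)
    finally have "(\<i>\<d> X \<otimes> \<c> (Y \<odot> Y) X) \<cdot> (?c \<otimes> \<i>\<d> (Y \<odot> X)) =
        ?last \<cdot> ((\<i>\<d> (X \<odot> Y) \<otimes> ?c) \<cdot> (?c \<otimes> \<i>\<d> (Y \<odot> X)))"
      by (simp add: Comp_assoc_arr)
    then show ?thesis by (simp add: interchange_arr)
  qed
  have right: "(\<c> Y (X \<odot> X) \<otimes> \<i>\<d> Y) \<cdot> (\<i>\<d> (Y \<odot> X) \<otimes> ?c) = ?last \<cdot> (?c \<otimes> ?c)"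
  proof -
    have "\<c> Y (X \<odot> X) \<otimes> \<i>\<d> Y = ((\<i>\<d> X \<otimes> ?c) \<otimes> \<i>\<d> Y) \<cdot> ((?c \<otimes> \<i>\<d> X) \<otimes> \<i>\<d> Y)"
      by (subst interchange_arr) (simp_all add: hexagon2)
    also have "(?c \<otimes> \<i>\<d> X) \<otimes> \<i>\<d> Y = ?c \<otimes> \<i>\<d> (X \<odot> Y)"
      by simp
    finally have "(\<c> Y (X \<odot> X) \<otimes> \<i>\<d> Y) \<cdot> (\<i>\<d> (Y \<odot> X) \<otimes> ?c) =
        ?last \<cdot> ((?c \<otimes> \<i>\<d> (X \<odot> Y)) \<cdot> (\<i>\<d> (Y \<odot> X) \<otimes> ?c))"
      by (simp add: Comp_assoc_arr)
    then show ?thesis by (simp add: interchange_arr)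
  qed
  have "(\<i>\<d> (X \<odot> X) \<otimes> (\<c> (Y \<odot> Y) X \<otimes> \<i>\<d> Y)) \<cdot> (s \<otimes> \<i>\<d> (X \<odot> Y)) =
      (\<i>\<d> X \<otimes> ((\<i>\<d> X \<otimes> \<c> (Y \<odot> Y) X) \<otimes> \<i>\<d> Y)) \<cdot> (\<i>\<d> X \<otimes> ((?c \<otimes> \<i>\<d> (Y \<odot> X)) \<otimes> \<i>\<d> Y))"
    by (simp add: s_def flip: TensorA_Id)
  also have "\<dots> = \<i>\<d> X \<otimes> ((?last \<cdot> (?c \<otimes> ?c)) \<otimes> \<i>\<d> Y)"
    by (subst interchange3) (simp_all only: left, simp_all)
  also have "\<dots> = \<i>\<d> X \<otimes> (((\<c> Y (X \<odot> X) \<otimes> \<i>\<d> Y) \<cdot> (\<i>\<d> (Y \<odot> X) \<otimes> ?c)) \<otimes> \<i>\<d> Y)"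
    by (simp only: right)
  also have "\<dots> = (\<i>\<d> X \<otimes> ((\<c> Y (X \<odot> X) \<otimes> \<i>\<d> Y) \<otimes> \<i>\<d> Y)) \<cdot>
      (\<i>\<d> X \<otimes> ((\<i>\<d> (Y \<odot> X) \<otimes> ?c) \<otimes> \<i>\<d> Y))"
    by (subst interchange3) simp_all
  also have "\<dots> = (\<i>\<d> X \<otimes> (\<c> Y (X \<odot> X) \<otimes> \<i>\<d> (Y \<odot> Y))) \<cdot> (\<i>\<d> (X \<odot> Y) \<otimes> s)"
    by (simp add: s_def flip: TensorA_Id)
  finally show ?thesis .
qed

text \<open>Moving the inner multiplications past the outer swap writes both bracketings of a triple
  product as a tensor product of bracketed products in \<open>A\<close> and in \<open>B\<close> after a permutation.
  The products agree by associativity of \<open>A\<close> and \<open>B\<close>, the permutations by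
  \<open>middle_swap_assoc\<close>.\<close>

lemma tensor_monoid_object:
  assumes "monoid_object C A" "monoid_object C B"
  shows "monoid_object C (A \<otimes>\<^sub>M B)"
proof -
  interpret A: monoid_object C A by fact
  interpret B: monoid_object C B by fact
  let ?a = "\<i>\<d> (obj A)" and ?b = "\<i>\<d> (obj B)"
  let ?s = "?a \<otimes> (\<c> (obj B) (obj A) \<otimes> ?b)"
  let ?\<mu> = "\<mu>\<^bsub>A\<^esub> \<otimes> \<mu>\<^bsub>B\<^esub>"
  have unit_left: "?\<mu> \<cdot> ?s \<cdot> ((\<eta>\<^bsub>A\<^esub> \<otimes> \<eta>\<^bsub>B\<^esub>) \<otimes> (?a \<otimes> ?b)) = \<i>\<d> (obj A \<odot> obj B)"
  proof -
    have "?\<mu> \<cdot> ?s \<cdot> ((\<eta>\<^bsub>A\<^esub> \<otimes> \<eta>\<^bsub>B\<^esub>) \<otimes> (?a \<otimes> ?b)) = ?\<mu> \<cdot> ((\<eta>\<^bsub>A\<^esub> \<otimes> ?a) \<otimes> (\<eta>\<^bsub>B\<^esub> \<otimes> ?b))"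
      by (subst middle_swap_natural) simp_all
    also have "\<dots> = \<i>\<d> (obj A \<odot> obj B)"
      by (subst interchange_arr) (simp_all add: A.unit_left B.unit_left)
    finally show ?thesis .
  qed
  have unit_right: "?\<mu> \<cdot> ?s \<cdot> ((?a \<otimes> ?b) \<otimes> (\<eta>\<^bsub>A\<^esub> \<otimes> \<eta>\<^bsub>B\<^esub>)) = \<i>\<d> (obj A \<odot> obj B)"
  proof -
    have "?\<mu> \<cdot> ?s \<cdot> ((?a \<otimes> ?b) \<otimes> (\<eta>\<^bsub>A\<^esub> \<otimes> \<eta>\<^bsub>B\<^esub>)) = ?\<mu> \<cdot> ((?a \<otimes> \<eta>\<^bsub>A\<^esub>) \<otimes> (?b \<otimes> \<eta>\<^bsub>B\<^esub>))"
      by (subst middle_swap_natural) simp_all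
    also have "\<dots> = \<i>\<d> (obj A \<odot> obj B)"
      by (subst interchange_arr) (simp_all add: A.unit_right B.unit_right)
    finally show ?thesis .
  qed
  let ?l = "\<i>\<d> (obj A \<odot> obj A) \<otimes> (\<c> (obj B \<odot> obj B) (obj A) \<otimes> ?b)"
  let ?r = "?a \<otimes> (\<c> (obj B) (obj A \<odot> obj A) \<otimes> \<i>\<d> (obj B \<odot> obj B))"
  have mult_left: "(?\<mu> \<cdot> ?s) \<cdot> ((?\<mu> \<cdot> ?s) \<otimes> \<i>\<d> (obj A \<odot> obj B)) =
      ((\<mu>\<^bsub>A\<^esub> \<cdot> (\<mu>\<^bsub>A\<^esub> \<otimes> ?a)) \<otimes> (\<mu>\<^bsub>B\<^esub> \<cdot> (\<mu>\<^bsub>B\<^esub> \<otimes> ?b))) \<cdot> (?l \<cdot> (?s \<otimes> \<i>\<d> (obj A \<odot> obj B)))"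
  proof -
    have split: "(?\<mu> \<cdot> ?s) \<otimes> \<i>\<d> (obj A \<odot> obj B) =
        (?\<mu> \<otimes> (?a \<otimes> ?b)) \<cdot> (?s \<otimes> \<i>\<d> (obj A \<odot> obj B))"
      by (subst interchange_arr) simp_all
    have swap: "?s \<cdot> (?\<mu> \<otimes> (?a \<otimes> ?b)) = ((\<mu>\<^bsub>A\<^esub> \<otimes> ?a) \<otimes> (\<mu>\<^bsub>B\<^esub> \<otimes> ?b)) \<cdot> ?l"
      by (subst middle_swap_natural) simp_all
    have "(?\<mu> \<cdot> ?s) \<cdot> ((?\<mu> \<cdot> ?s) \<otimes> \<i>\<d> (obj A \<odot> obj B)) =
        ?\<mu> \<cdot> ((?s \<cdot> (?\<mu> \<otimes> (?a \<otimes> ?b))) \<cdot> (?s \<otimes> \<i>\<d> (obj A \<odot> obj B)))"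
      unfolding split by (simp add: Comp_assoc_arr)
    also have "\<dots> = (?\<mu> \<cdot> ((\<mu>\<^bsub>A\<^esub> \<otimes> ?a) \<otimes> (\<mu>\<^bsub>B\<^esub> \<otimes> ?b))) \<cdot> (?l \<cdot> (?s \<otimes> \<i>\<d> (obj A \<odot> obj B)))"
      unfolding swap by (simp add: Comp_assoc_arr)
    also have "?\<mu> \<cdot> ((\<mu>\<^bsub>A\<^esub> \<otimes> ?a) \<otimes> (\<mu>\<^bsub>B\<^esub> \<otimes> ?b)) =
        (\<mu>\<^bsub>A\<^esub> \<cdot> (\<mu>\<^bsub>A\<^esub> \<otimes> ?a)) \<otimes> (\<mu>\<^bsub>B\<^esub> \<cdot> (\<mu>\<^bsub>B\<^esub> \<otimes> ?b))"
      by (rule interchange_arr) simp_all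
    finally show ?thesis .
  qed
  have mult_right: "(?\<mu> \<cdot> ?s) \<cdot> (\<i>\<d> (obj A \<odot> obj B) \<otimes> (?\<mu> \<cdot> ?s)) =
      ((\<mu>\<^bsub>A\<^esub> \<cdot> (?a \<otimes> \<mu>\<^bsub>A\<^esub>)) \<otimes> (\<mu>\<^bsub>B\<^esub> \<cdot> (?b \<otimes> \<mu>\<^bsub>B\<^esub>))) \<cdot> (?r \<cdot> (\<i>\<d> (obj A \<odot> obj B) \<otimes> ?s))"
  proof -
    have split: "\<i>\<d> (obj A \<odot> obj B) \<otimes> (?\<mu> \<cdot> ?s) =
        ((?a \<otimes> ?b) \<otimes> ?\<mu>) \<cdot> (\<i>\<d> (obj A \<odot> obj B) \<otimes> ?s)"
      by (subst interchange_arr) simp_all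
    have swap: "?s \<cdot> ((?a \<otimes> ?b) \<otimes> ?\<mu>) = ((?a \<otimes> \<mu>\<^bsub>A\<^esub>) \<otimes> (?b \<otimes> \<mu>\<^bsub>B\<^esub>)) \<cdot> ?r"
      by (subst middle_swap_natural) simp_all
    have "(?\<mu> \<cdot> ?s) \<cdot> (\<i>\<d> (obj A \<odot> obj B) \<otimes> (?\<mu> \<cdot> ?s)) =
        ?\<mu> \<cdot> ((?s \<cdot> ((?a \<otimes> ?b) \<otimes> ?\<mu>)) \<cdot> (\<i>\<d> (obj A \<odot> obj B) \<otimes> ?s))"
      unfolding split by (simp add: Comp_assoc_arr)
    also have "\<dots> = (?\<mu> \<cdot> ((?a \<otimes> \<mu>\<^bsub>A\<^esub>) \<otimes> (?b \<otimes> \<mu>\<^bsub>B\<^esub>))) \<cdot> (?r \<cdot> (\<i>\<d> (obj A \<odot> obj B) \<otimes> ?s))"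
      unfolding swap by (simp add: Comp_assoc_arr)
    also have "?\<mu> \<cdot> ((?a \<otimes> \<mu>\<^bsub>A\<^esub>) \<otimes> (?b \<otimes> \<mu>\<^bsub>B\<^esub>)) =
        (\<mu>\<^bsub>A\<^esub> \<cdot> (?a \<otimes> \<mu>\<^bsub>A\<^esub>)) \<otimes> (\<mu>\<^bsub>B\<^esub> \<cdot> (?b \<otimes> \<mu>\<^bsub>B\<^esub>))"
      by (rule interchange_arr) simp_all
    finally show ?thesis .
  qed
  have assoc: "(?\<mu> \<cdot> ?s) \<cdot> ((?\<mu> \<cdot> ?s) \<otimes> \<i>\<d> (obj A \<odot> obj B)) =
      (?\<mu> \<cdot> ?s) \<cdot> (\<i>\<d> (obj A \<odot> obj B) \<otimes> (?\<mu> \<cdot> ?s))"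
    unfolding mult_left mult_right
    by (simp only: A.mult_assoc B.mult_assoc middle_swap_assoc A.obj_in B.obj_in)
  show ?thesis
  proof unfold_locales
    show "obj (A \<otimes>\<^sub>M B) \<in> Obj C" "\<eta>\<^bsub>A \<otimes>\<^sub>M B\<^esub> \<in> Hom \<K> (obj (A \<otimes>\<^sub>M B))"
      "\<mu>\<^bsub>A \<otimes>\<^sub>M B\<^esub> \<in> Hom (obj (A \<otimes>\<^sub>M B) \<odot> obj (A \<otimes>\<^sub>M B)) (obj (A \<otimes>\<^sub>M B))"
      by (simp_all add: hom_iff)
    show "\<mu>\<^bsub>A \<otimes>\<^sub>M B\<^esub> \<cdot> (\<eta>\<^bsub>A \<otimes>\<^sub>M B\<^esub> \<otimes> \<i>\<d> (obj (A \<otimes>\<^sub>M B))) = \<i>\<d> (obj (A \<otimes>\<^sub>M B))"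
      using unit_left by (simp add: Comp_assoc_arr)
    show "\<mu>\<^bsub>A \<otimes>\<^sub>M B\<^esub> \<cdot> (\<i>\<d> (obj (A \<otimes>\<^sub>M B)) \<otimes> \<eta>\<^bsub>A \<otimes>\<^sub>M B\<^esub>) = \<i>\<d> (obj (A \<otimes>\<^sub>M B))"
      using unit_right by (simp add: Comp_assoc_arr)
    show "\<mu>\<^bsub>A \<otimes>\<^sub>M B\<^esub> \<cdot> (\<mu>\<^bsub>A \<otimes>\<^sub>M B\<^esub> \<otimes> \<i>\<d> (obj (A \<otimes>\<^sub>M B))) =
        \<mu>\<^bsub>A \<otimes>\<^sub>M B\<^esub> \<cdot> (\<i>\<d> (obj (A \<otimes>\<^sub>M B)) \<otimes> \<mu>\<^bsub>A \<otimes>\<^sub>M B\<^esub>)"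
      using assoc by simp
  qed
qed

lemma tensor_monoid_morphism:
  assumes "monoid_object C A" "monoid_object C B" "monoid_object C A'" "monoid_object C B'"
    and f: "monoid_morphism C A A' f" and g: "monoid_morphism C B B' g"
  shows "monoid_morphism C (A \<otimes>\<^sub>M B) (A' \<otimes>\<^sub>M B') (f \<otimes> g)"
proof -
  interpret A: monoid_object C A by fact
  interpret B: monoid_object C B by fact
  interpret A': monoid_object C A' by fact
  interpret B': monoid_object C B' by fact
  note [simp] = f[unfolded monoid_morphism_def hom_iff] g[unfolded monoid_morphism_def hom_iff]
  let ?s = "\<i>\<d> (obj A) \<otimes> (\<c> (obj B) (obj A) \<otimes> \<i>\<d> (obj B))"
  let ?s' = "\<i>\<d> (obj A') \<otimes> (\<c> (obj B') (obj A') \<otimes> \<i>\<d> (obj B'))"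
  have swap: "((f \<otimes> f) \<otimes> (g \<otimes> g)) \<cdot> ?s = ?s' \<cdot> ((f \<otimes> g) \<otimes> (f \<otimes> g))"
    by (subst middle_swap_natural) simp_all
  have "(f \<otimes> g) \<cdot> (\<mu>\<^bsub>A\<^esub> \<otimes> \<mu>\<^bsub>B\<^esub>) \<cdot> ?s = ((f \<otimes> g) \<cdot> (\<mu>\<^bsub>A\<^esub> \<otimes> \<mu>\<^bsub>B\<^esub>)) \<cdot> ?s"
    by (simp add: Comp_assoc_arr)
  also have "(f \<otimes> g) \<cdot> (\<mu>\<^bsub>A\<^esub> \<otimes> \<mu>\<^bsub>B\<^esub>) = (\<mu>\<^bsub>A'\<^esub> \<otimes> \<mu>\<^bsub>B'\<^esub>) \<cdot> ((f \<otimes> f) \<otimes> (g \<otimes> g))"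
    by (simp add: interchange_arr del: TensorA_assoc)
  also have "\<dots> \<cdot> ?s = (\<mu>\<^bsub>A'\<^esub> \<otimes> \<mu>\<^bsub>B'\<^esub>) \<cdot> (((f \<otimes> f) \<otimes> (g \<otimes> g)) \<cdot> ?s)"
    by (simp add: Comp_assoc_arr)
  also have "\<dots> = ((\<mu>\<^bsub>A'\<^esub> \<otimes> \<mu>\<^bsub>B'\<^esub>) \<cdot> ?s') \<cdot> ((f \<otimes> g) \<otimes> (f \<otimes> g))"
    unfolding swap by (simp add: Comp_assoc_arr)
  finally have "(f \<otimes> g) \<cdot> \<mu>\<^bsub>A \<otimes>\<^sub>M B\<^esub> = \<mu>\<^bsub>A' \<otimes>\<^sub>M B'\<^esub> \<cdot> ((f \<otimes> g) \<otimes> (f \<otimes> g))"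
    by simp
  then show ?thesis
    unfolding monoid_morphism_def by (simp add: hom_iff interchange_arr)
qed

lemma unit_monoid_object: "monoid_object C (unit_monoid C)"
  by unfold_locales (simp_all add: unit_monoid_def hom_iff)

text \<open>By strictness and \<open>Sym_unit\<close>, tensoring with the unit monoid changes neither the object nor
  the unit nor the multiplication.\<close>

lemma tensor_unit_monoid:
  assumes "monoid_object C B"
  shows "monoid_morphism C A (unit_monoid C \<otimes>\<^sub>M B) f \<longleftrightarrow> monoid_morphism C A B f"
    "monoid_morphism C A (B \<otimes>\<^sub>M unit_monoid C) f \<longleftrightarrow> monoid_morphism C A B f"
proof -
  interpret B: monoid_object C B by fact
  show "monoid_morphism C A (unit_monoid C \<otimes>\<^sub>M B) f \<longleftrightarrow> monoid_morphism C A B f"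
    "monoid_morphism C A (B \<otimes>\<^sub>M unit_monoid C) f \<longleftrightarrow> monoid_morphism C A B f"
    by (simp_all add: monoid_morphism_def unit_monoid_def)
qed

end

section \<open>Twist deformation\<close>

lemma (in noncoassociative_bimonoid) bimonoid_typing [simp]:
  "\<delta>\<^bsub>H\<^esub> \<in> Arr C" "Dom C \<delta>\<^bsub>H\<^esub> = obj H" "Cod C \<delta>\<^bsub>H\<^esub> = obj H \<odot> obj H"
  "\<epsilon>\<^bsub>H\<^esub> \<in> Arr C" "Dom C \<epsilon>\<^bsub>H\<^esub> = obj H" "Cod C \<epsilon>\<^bsub>H\<^esub> = \<K>"
  using comult_in counit_in by (simp_all add: hom_iff)

text \<open>The axioms on \<open>\<epsilon>\<close> say that it is a monoid morphism to the unit monoid, so both maps are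
  tensor products of monoid morphisms.\<close>

lemma (in noncoassociative_bimonoid) counit_tensor_morphism:
  "monoid_morphism C (H \<otimes>\<^sub>M H) H (\<epsilon>\<^bsub>H\<^esub> \<otimes> \<i>\<d> (obj H))"
  "monoid_morphism C (H \<otimes>\<^sub>M H) H (\<i>\<d> (obj H) \<otimes> \<epsilon>\<^bsub>H\<^esub>)"
proof -
  have "monoid_morphism C H (unit_monoid C) \<epsilon>\<^bsub>H\<^esub>"
    by (simp add: monoid_morphism_def unit_monoid_def hom_iff counit_unit counit_mult)
  with tensor_monoid_morphism[of H H "unit_monoid C" H]
    tensor_monoid_morphism[of H H H "unit_monoid C"]
  show "monoid_morphism C (H \<otimes>\<^sub>M H) H (\<epsilon>\<^bsub>H\<^esub> \<otimes> \<i>\<d> (obj H))"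
    "monoid_morphism C (H \<otimes>\<^sub>M H) H (\<i>\<d> (obj H) \<otimes> \<epsilon>\<^bsub>H\<^esub>)"
    using monoid_object_axioms unit_monoid_object monoid_morphism_id
    by (simp_all add: tensor_unit_monoid)
qed

text \<open>Since \<open>\<phi>\<close> sends \<open>j\<close> to the unit, it sends \<open>i\<close> to the unit as well, hence it does not see the
  conjugation.\<close>

lemma (in monoid_object) morphism_conjugate:
  assumes \<phi>: "monoid_morphism C A B \<phi>" and "monoid_object C B"
    and i: "i \<in> Hom \<K> (obj A)" and j: "j \<in> Hom \<K> (obj A)"
    and ij: "convolution C A i j = \<eta>\<^bsub>A\<^esub>" and \<phi>j: "\<phi> \<cdot> j = \<eta>\<^bsub>B\<^esub>"
    and f: "f \<in> Arr C" "Cod C f = obj A"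
  shows "\<phi> \<cdot> convolution C A (convolution C A i f) j = \<phi> \<cdot> f"
proof -
  interpret B: monoid_object C B by fact
  note [simp] = f i[unfolded hom_iff] j[unfolded hom_iff] \<phi>[unfolded monoid_morphism_def hom_iff]
  note push = monoid_morphism_convolution[OF \<phi> assms(2)]
  \<comment> \<open>\<open>\<phi> \<cdot> (i * j) = (\<phi> \<cdot> i) * \<eta>\<close>, and \<open>\<phi>\<close> preserves the unit \<open>i * j\<close>.\<close>
  have "\<phi> \<cdot> i = \<phi> \<cdot> convolution C A i j"
    by (simp add: push \<phi>j)
  then have "\<phi> \<cdot> i = \<eta>\<^bsub>B\<^esub>"
    by (simp add: ij)
  then show ?thesis
    by (simp add: push \<phi>j)
qed

theorem theorem3p1p5:
  fixes C :: "('o, 'm) monoidal_data"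
    and H :: "('o, 'm) bimonoid_data"
    and J :: 'm
  assumes "strict_symmetric_monoidal_category C"
    and "noncoassociative_bimonoid C H"
    and "twist C H J"
    and "conormal C H J"
  shows "noncoassociative_bimonoid C (twist_deformation C H J)"
proof -
  interpret H: noncoassociative_bimonoid C H by fact
  let ?HH = "H \<otimes>\<^sub>M\<^bsub>C\<^esub> H"
  interpret HH: monoid_object C ?HH
    by (intro H.tensor_monoid_object H.monoid_object_axioms)
  let ?i = "convolution_inverse C ?HH J" and ?d = "\<delta>\<^bsub>H\<^esub>"
  let ?conv = "convolution C ?HH"
  have J: "J \<in> Hom\<^bsub>C\<^esub> \<K>\<^bsub>C\<^esub> (obj ?HH)" and inv: "is_convolution_inverse C ?HH J ?i"
    using assms(3) HH.convolution_inverse by (auto simp: twist_def)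
  have [simp]: "J \<in> Arr C" "Dom C J = \<K>\<^bsub>C\<^esub>" "Cod C J = obj ?HH"
    using J by (simp_all add: H.hom_iff)
  have [simp]: "?i \<in> Arr C" "Dom C ?i = \<K>\<^bsub>C\<^esub>" "Cod C ?i = obj ?HH"
    and JiJ [simp]: "?conv J ?i = \<eta>\<^bsub>?HH\<^esub>" "?conv ?i J = \<eta>\<^bsub>?HH\<^esub>"
    using inv by (simp_all add: is_convolution_inverse_def H.hom_iff)
  have i: "?i \<in> Hom\<^bsub>C\<^esub> \<K>\<^bsub>C\<^esub> (obj ?HH)"
    by (simp add: H.hom_iff)
  let ?t = "twisted_comult C H J"
  have t: "?t = ?conv (?conv ?i ?d) J"
  proof -
    have "?conv (?conv ?i ?d) J =
        \<mu>\<^bsub>?HH\<^esub> \<cdot>\<^bsub>C\<^esub> ((\<mu>\<^bsub>?HH\<^esub> \<otimes>\<^bsub>C\<^esub> \<i>\<d>\<^bsub>C\<^esub> (obj ?HH)) \<cdot>\<^bsub>C\<^esub> ((?i \<otimes>\<^bsub>C\<^esub> ?d) \<otimes>\<^bsub>C\<^esub> J))"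
      unfolding convolution_def by (subst H.interchange_arr) (simp_all del: tensor_monoid_sel(3))
    also have "\<i>\<d>\<^bsub>C\<^esub> (obj ?HH) = \<i>\<d>\<^bsub>C\<^esub> (obj H) \<otimes>\<^bsub>C\<^esub> \<i>\<d>\<^bsub>C\<^esub> (obj H)"
      by simp
    finally show ?thesis
      unfolding twisted_comult_def
      by (simp add: H.TensorA_assoc del: H.TensorA_Id tensor_monoid_sel(3))
  qed
  have t_in: "?t \<in> Hom\<^bsub>C\<^esub> (obj H) (obj H \<odot>\<^bsub>C\<^esub> obj H)"
    by (simp add: t H.hom_iff)
  have comult_unit: "?t \<cdot>\<^bsub>C\<^esub> \<eta>\<^bsub>H\<^esub> = \<eta>\<^bsub>H\<^esub> \<otimes>\<^bsub>C\<^esub> \<eta>\<^bsub>H\<^esub>"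
  proof -
    have "?t \<cdot>\<^bsub>C\<^esub> \<eta>\<^bsub>H\<^esub> = ?conv (?conv ?i \<eta>\<^bsub>?HH\<^esub>) J"
      unfolding t using HH.conjugate_comp[OF i J, of ?d "\<eta>\<^bsub>H\<^esub>"] by (simp add: H.comult_unit)
    also have "\<dots> = \<eta>\<^bsub>?HH\<^esub>"
      by (simp del: tensor_monoid_sel(2) add: HH.convolution_unit JiJ)
    finally show ?thesis by simp
  qed
  have comult_mult: "?t \<cdot>\<^bsub>C\<^esub> \<mu>\<^bsub>H\<^esub> = \<mu>\<^bsub>?HH\<^esub> \<cdot>\<^bsub>C\<^esub> (?t \<otimes>\<^bsub>C\<^esub> ?t)"
  proof -
    have "?t \<cdot>\<^bsub>C\<^esub> \<mu>\<^bsub>H\<^esub> = ?conv (?conv ?i (?d \<cdot>\<^bsub>C\<^esub> \<mu>\<^bsub>H\<^esub>)) J"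
      unfolding t using HH.conjugate_comp[OF i J, of ?d "\<mu>\<^bsub>H\<^esub>"] by simp
    also have "?d \<cdot>\<^bsub>C\<^esub> \<mu>\<^bsub>H\<^esub> = ?conv ?d ?d"
      by (simp only: H.comult_mult convolution_def)
    also have "?conv (?conv ?i (?conv ?d ?d)) J = ?conv ?t ?t"
      unfolding t by (rule HH.conjugate_convolution[OF i J JiJ(1)]) simp_all
    finally show ?thesis by (simp only: convolution_def)
  qed
  have counit: "\<phi> \<cdot>\<^bsub>C\<^esub> ?t = \<phi> \<cdot>\<^bsub>C\<^esub> ?d"
    if "monoid_morphism C ?HH H \<phi>" "\<phi> \<cdot>\<^bsub>C\<^esub> J = \<eta>\<^bsub>H\<^esub>" for \<phi>
    unfolding t using that
    by (intro HH.morphism_conjugate[OF _ H.monoid_object_axioms i J JiJ(2)]) simp_all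
  have counit_left: "(\<epsilon>\<^bsub>H\<^esub> \<otimes>\<^bsub>C\<^esub> \<i>\<d>\<^bsub>C\<^esub> (obj H)) \<cdot>\<^bsub>C\<^esub> ?t = \<i>\<d>\<^bsub>C\<^esub> (obj H)"
    and counit_right: "(\<i>\<d>\<^bsub>C\<^esub> (obj H) \<otimes>\<^bsub>C\<^esub> \<epsilon>\<^bsub>H\<^esub>) \<cdot>\<^bsub>C\<^esub> ?t = \<i>\<d>\<^bsub>C\<^esub> (obj H)"
    using assms(4) counit H.counit_tensor_morphism H.counit_left H.counit_right
    by (simp_all add: conormal_def)
  have sel: "obj (twist_deformation C H J) = obj H" "\<eta>\<^bsub>twist_deformation C H J\<^esub> = \<eta>\<^bsub>H\<^esub>"
    "\<mu>\<^bsub>twist_deformation C H J\<^esub> = \<mu>\<^bsub>H\<^esub>" "\<epsilon>\<^bsub>twist_deformation C H J\<^esub> = \<epsilon>\<^bsub>H\<^esub>"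
    "\<delta>\<^bsub>twist_deformation C H J\<^esub> = ?t"
    by (simp_all add: twist_deformation_def)
  show ?thesis
    using comult_mult
    by unfold_locales
      (simp_all add: sel H.mult_assoc H.unit_left H.unit_right H.unit_in H.mult_in H.counit_in t_in
        H.counit_unit H.counit_mult counit_left counit_right comult_unit)
qed

end
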